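(* Let $N\geq 1$, and for $q\in\mathbb T^N$ write $q_i=e^{{\rm i}\alpha_i}$, viewing functions of $q$ as functions of $(\alpha_0,\ldots,\alpha_{N-1})\in\mathbb R^N$. Let $$\Phi=\sum_{\substack{i,j,k,l\in\mathbb Z_N\\ i+k=j+l}}\frac{q_iq_k}{q_jq_l},\qquad \Phi_i=\sum_{\substack{j,k,l\in\mathbb Z_N\\ i+k=j+l}}\frac{q_iq_k}{q_jq_l}\quad(i\in\mathbb Z_N),$$ so that $\Phi=\Phi_0+\cdots+\Phi_{N-1}$. Then: (1) $\Phi\in\mathbb R$ and $\Phi\geq N^2$, with equality when $\sqrt N FQF^*$ is a complex Hadamard matrix. (2) $q$ is a critical point of $\Phi$ (i.e. $\partial\Phi/\partial\alpha_i=0$ for all $i$) if and only if $\Phi_i\in\mathbb R$ for every $i$. (3) If $\sqrt N FQF^*$ is a complex Hadamard matrix, then $\Phi_i=N$ for every $i$.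
   Context: $\mathbb T$ is the unit circle in $\mathbb C$; indices are modulo $N$. $F=(w^{ij})_{i,j=0}^{N-1}/\sqrt N$ with $w=e^{2\pi{\rm i}/N}$, and $Q=\mathrm{diag}(q_0,\ldots,q_{N-1})$. A complex Hadamard matrix is a square matrix whose entries have modulus $1$ and whose rows are pairwise orthogonal. *)

theory Defs
  imports
    "Jordan_Normal_Form.Schur_Decomposition"
    "HOL-Number_Theory.Cong"
begin

text \<open>
  The index set \<open>\<int>\<^sub>N\<close> is represented by the naturals below \<open>N\<close>, with equations between
  indices read modulo \<open>N\<close>. A point of the torus is a function \<open>q :: nat \<Rightarrow> complex\<close> of which only
  the values below \<open>N\<close> matter.
\<close>

definition fourier_mat :: "nat \<Rightarrow> complex mat" where
  "fourier_mat N =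
     mat N N (\<lambda>(i, j). exp (2 * of_real pi * \<i> / of_nat N) ^ (i * j) / of_real (sqrt (real N)))"

definition complex_hadamard :: "complex mat \<Rightarrow> bool" where
  "complex_hadamard A \<longleftrightarrow>
     square_mat A \<and>
     (\<forall>i<dim_row A. \<forall>j<dim_col A. cmod (A $$ (i, j)) = 1) \<and>
     (\<forall>i<dim_row A. \<forall>j<dim_row A. i \<noteq> j \<longrightarrow> row A i \<bullet>c row A j = 0)"

definition circulant_of :: "nat \<Rightarrow> (nat \<Rightarrow> complex) \<Rightarrow> complex mat" where
  "circulant_of N q =
     complex_of_real (sqrt (real N)) \<cdot>\<^sub>m
       (fourier_mat N * mat_diag N q * mat_adjoint (fourier_mat N))"

definition Phi :: "nat \<Rightarrow> (nat \<Rightarrow> complex) \<Rightarrow> complex" where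
  "Phi N q =
     (\<Sum>(i, j, k, l) \<in> {(i, j, k, l). i < N \<and> j < N \<and> k < N \<and> l < N \<and> [i + k = j + l] (mod N)}.
        (q i * q k) / (q j * q l))"

definition Phi_at :: "nat \<Rightarrow> (nat \<Rightarrow> complex) \<Rightarrow> nat \<Rightarrow> complex" where
  "Phi_at N q i =
     (\<Sum>(j, k, l) \<in> {(j, k, l). j < N \<and> k < N \<and> l < N \<and> [i + k = j + l] (mod N)}.
        (q i * q k) / (q j * q l))"

definition torus_pt :: "(nat \<Rightarrow> real) \<Rightarrow> nat \<Rightarrow> complex" where
  "torus_pt \<alpha> i = exp (\<i> * of_real (\<alpha> i))"

text \<open>
  The derivative in the \<open>i\<close>-th angle is taken for \<open>Phi\<close> as a complex-valued function of a real
  variable, so both its real and its imaginary part are required to be stationary.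
\<close>

definition critical_point_Phi :: "nat \<Rightarrow> (nat \<Rightarrow> real) \<Rightarrow> bool" where
  "critical_point_Phi N \<alpha> \<longleftrightarrow>
     (\<forall>i<N. ((\<lambda>t. Phi N (torus_pt (\<alpha>(i := t)))) has_vector_derivative 0) (at (\<alpha> i)))"

end

theory Submission
  imports Defs "HOL-Analysis.Complex_Transcendental"
begin

text \<open>
  Let \<open>g(a) = \<Sum>\<^sub>j q\<^sub>j w\<^bsup>aj\<^esup>\<close>. Detecting the relation \<open>i + k = j + l\<close> by characters gives
  \<open>N \<Phi>\<^sub>i = \<Sum>\<^sub>a q\<^sub>i w\<^bsup>ai\<^esup> cnj (g(a)) \<bar>g(a)\<bar>\<^sup>2\<close>, hence \<open>N \<Phi> = \<Sum>\<^sub>a \<bar>g(a)\<bar>\<^sup>4\<close>. As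
  \<open>\<Sum>\<^sub>a \<bar>g(a)\<bar>\<^sup>2 = N\<^sup>2\<close> by Parseval, \<open>\<Phi> \<ge> N\<^sup>2\<close> is the inequality \<open>\<Sum>\<^sub>a (\<bar>g(a)\<bar>\<^sup>2 - N)\<^sup>2 \<ge> 0\<close>. In the
  Hadamard case \<open>\<bar>g(a)\<bar>\<^sup>2 = N\<close> for all \<open>a\<close>, since the column \<open>0\<close> of the circulant matrix
  has entries \<open>g(a) / \<surd>N\<close>, and Fourier inversion yields \<open>\<Phi>\<^sub>i = N\<close>. The
  exchanges of indices in \<open>i + k = j + l\<close> give \<open>\<partial>\<Phi>/\<partial>\<alpha>\<^sub>i = 2\<i> (\<Phi>\<^sub>i - cnj \<Phi>\<^sub>i) = -4 Im \<Phi>\<^sub>i\<close>.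
\<close>

section \<open>Roots of unity and orthogonality of characters\<close>

definition root1 :: "nat \<Rightarrow> complex" where
  "root1 N = exp (2 * of_real pi * \<i> / of_nat N)"

text \<open>Unnormalised, with the sign of \<open>fourier_mat\<close>: it is \<open>sqrt N\<close>
  times the Fourier matrix applied to \<open>q\<close>.\<close>

definition dft :: "nat \<Rightarrow> (nat \<Rightarrow> complex) \<Rightarrow> nat \<Rightarrow> complex" where
  "dft N q a = (\<Sum>j<N. q j * root1 N ^ (a * j))"

lemma norm_root1 [simp]: "cmod (root1 N) = 1"
  by (simp add: root1_def norm_exp_eq_Re)

lemma root1_power_eq_iff:
  assumes "N \<ge> 1"
  shows "root1 N ^ x = root1 N ^ y \<longleftrightarrow> [x = y] (mod N)"
proof -
  have "root1 N ^ n = exp (2 * of_real pi * \<i> * of_nat n / of_nat N)" for n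
    unfolding root1_def exp_of_nat_mult [symmetric] by (simp add: mult_ac)
  then show ?thesis
    using complex_root_unity_eq [OF assms, of x y] by (simp add: cong_def)
qed

text \<open>On the unit circle conjugation is inversion. The conjugate stands for a negative
  exponent, so no subtraction of naturals arises.\<close>

lemma root1_power_mult_cnj_eq_1_iff:
  assumes "N \<ge> 1"
  shows "root1 N ^ x * cnj (root1 N ^ y) = 1 \<longleftrightarrow> [x = y] (mod N)"
proof -
  have "root1 N ^ y * cnj (root1 N ^ y) = 1"
    unfolding complex_norm_square [symmetric] by (simp add: norm_power)
  then have inv: "cnj (root1 N ^ y) = inverse (root1 N ^ y)"
    by (rule inverse_unique [symmetric])
  have "root1 N \<noteq> 0"
    by (simp add: root1_def)
  then show ?thesis
    unfolding inv using root1_power_eq_iff [OF assms, of x y] by (simp add: field_simps)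
qed

text \<open>A geometric sum whose ratio is an \<open>N\<close>-th root of unity: it vanishes unless
  the ratio is 1.\<close>

lemma sum_root1_orthogonal:
  assumes "N \<ge> 1"
  shows "(\<Sum>a<N. root1 N ^ (a * x) * cnj (root1 N ^ (a * y)))
         = (if [x = y] (mod N) then of_nat N else 0)"
proof -
  define z where "z = root1 N ^ x * cnj (root1 N ^ y)"
  have z: "root1 N ^ (a * x) * cnj (root1 N ^ (a * y)) = z ^ a" for a
    by (simp add: z_def power_mult_distrib power_mult [symmetric] mult.commute)
  have "z ^ N = root1 N ^ (N * x) * cnj (root1 N ^ (N * y))"
    by (simp only: z)
  also have "\<dots> = 1"
    by (subst root1_power_mult_cnj_eq_1_iff [OF assms]) (simp add: cong_def)
  finally have "z ^ N = 1" .
  moreover have "z = 1 \<longleftrightarrow> [x = y] (mod N)"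
    unfolding z_def by (rule root1_power_mult_cnj_eq_1_iff [OF assms])
  ultimately show ?thesis
    unfolding z by (auto simp: sum_gp_strict)
qed

section \<open>Fourier expressions for \<open>Phi_at\<close> and \<open>Phi\<close>\<close>

text \<open>With the congruence as a condition on the summand, the sums can be exchanged, factored
  and differentiated term by term.\<close>

lemma Phi_at_eq_sum:
  "Phi_at N q i = (\<Sum>j<N. \<Sum>k<N. \<Sum>l<N.
     if [i + k = j + l] (mod N) then (q i * q k) / (q j * q l) else 0)"
proof -
  have "{(j, k, l). j < N \<and> k < N \<and> l < N \<and> [i + k = j + l] (mod N)}
      = {p \<in> {..<N} \<times> {..<N} \<times> {..<N}. case p of (j, k, l) \<Rightarrow> [i + k = j + l] (mod N)}"
    by auto
  then show ?thesis
    unfolding Phi_at_def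
    by (simp add: sum.inter_filter sum.cartesian_product case_prod_unfold)
qed

lemma Phi_eq_sum:
  "Phi N q = (\<Sum>i<N. \<Sum>j<N. \<Sum>k<N. \<Sum>l<N.
     if [i + k = j + l] (mod N) then (q i * q k) / (q j * q l) else 0)"
proof -
  have "{(i, j, k, l). i < N \<and> j < N \<and> k < N \<and> l < N \<and> [i + k = j + l] (mod N)}
      = {p \<in> {..<N} \<times> {..<N} \<times> {..<N} \<times> {..<N}.
          case p of (i, j, k, l) \<Rightarrow> [i + k = j + l] (mod N)}"
    by auto
  then show ?thesis
    unfolding Phi_def
    by (simp add: sum.inter_filter sum.cartesian_product case_prod_unfold)
qed

lemma Phi_eq_sum_Phi_at: "Phi N q = (\<Sum>i<N. Phi_at N q i)"
  by (simp add: Phi_eq_sum Phi_at_eq_sum)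

lemma divide_unimodular:
  assumes "cmod z = 1"
  shows "x / z = x * cnj z"
  using complex_div_cnj [of x z] assms by simp

lemma Phi_at_dft:
  assumes "N \<ge> 1" and "\<And>i. i < N \<Longrightarrow> cmod (q i) = 1" and "i < N"
  shows "of_nat N * Phi_at N q i =
    (\<Sum>a<N. q i * root1 N ^ (a * i) * cnj (dft N q a) * of_real ((cmod (dft N q a))\<^sup>2))"
proof -
  define u where "u a j = q j * root1 N ^ (a * j)" for a j
  let ?t = "\<lambda>a j k l. u a i * (cnj (u a j) * (u a k * cnj (u a l)))"
  \<comment> \<open>Since \<open>q\<close> is unimodular, \<open>1 / (q j * q l)\<close> is a
    conjugate; the sum over \<open>a\<close> of the remaining characters is \<open>N\<close> times
    the indicator of the congruence.\<close>
  have "of_nat N * (if [i + k = j + l] (mod N) then (q i * q k) / (q j * q l) else 0)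
      = (\<Sum>a<N. ?t a j k l)" if "j < N" "l < N" for j k l
  proof -
    have "(\<Sum>a<N. ?t a j k l) = (\<Sum>a<N. q i * q k * cnj (q j * q l) *
        (root1 N ^ (a * (i + k)) * cnj (root1 N ^ (a * (j + l)))))"
      by (simp add: u_def power_add distrib_left mult_ac)
    also have "\<dots> = q i * q k * cnj (q j * q l) * (if [i + k = j + l] (mod N) then of_nat N else 0)"
      by (simp only: sum_distrib_left [symmetric] sum_root1_orthogonal [OF assms(1)])
    finally show ?thesis
      using that by (simp add: divide_unimodular norm_mult assms(2))
  qed
  then have "of_nat N * Phi_at N q i = (\<Sum>j<N. \<Sum>k<N. \<Sum>l<N. \<Sum>a<N. ?t a j k l)"
    unfolding Phi_at_eq_sum sum_distrib_left by (intro sum.cong refl) simp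
  also have "\<dots> = (\<Sum>j<N. \<Sum>k<N. \<Sum>a<N. \<Sum>l<N. ?t a j k l)"
    by (intro sum.cong refl sum.swap)
  also have "\<dots> = (\<Sum>j<N. \<Sum>a<N. \<Sum>k<N. \<Sum>l<N. ?t a j k l)"
    by (intro sum.cong refl sum.swap)
  also have "\<dots> = (\<Sum>a<N. \<Sum>j<N. \<Sum>k<N. \<Sum>l<N. ?t a j k l)"
    by (rule sum.swap)
  \<comment> \<open>For fixed \<open>a\<close> the summand is a product of functions of single
    indices, so the triple sum factors.\<close>
  also have "\<dots> = (\<Sum>a<N. u a i *
      ((\<Sum>j<N. cnj (u a j)) * ((\<Sum>k<N. u a k) * (\<Sum>l<N. cnj (u a l)))))"
    by (simp only: sum_distrib_left [symmetric] sum_distrib_right [symmetric])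
  also have "\<dots> = (\<Sum>a<N. u a i * (cnj (dft N q a) * (dft N q a * cnj (dft N q a))))"
    by (simp only: dft_def u_def cnj_sum)
  finally show ?thesis
    by (simp only: complex_norm_square mult.assoc u_def)
qed

text \<open>Summing \<open>Phi_at_dft\<close> over \<open>i\<close> turns the factor
  \<open>q i * root1 N ^ (a * i)\<close> into \<open>dft N q a\<close>.\<close>

lemma Phi_dft:
  assumes "N \<ge> 1" and "\<And>i. i < N \<Longrightarrow> cmod (q i) = 1"
  shows "of_nat N * Phi N q = of_real (\<Sum>a<N. ((cmod (dft N q a))\<^sup>2)\<^sup>2)"
proof -
  let ?u = "\<lambda>a. cnj (dft N q a) * of_real ((cmod (dft N q a))\<^sup>2)"
  have "of_nat N * Phi N q = (\<Sum>i<N. \<Sum>a<N. q i * root1 N ^ (a * i) * ?u a)"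
    unfolding Phi_eq_sum_Phi_at sum_distrib_left
    by (intro sum.cong refl) (simp add: Phi_at_dft assms mult.assoc)
  also have "\<dots> = (\<Sum>a<N. \<Sum>i<N. q i * root1 N ^ (a * i) * ?u a)"
    by (rule sum.swap)
  also have "\<dots> = (\<Sum>a<N. dft N q a * ?u a)"
    by (simp only: dft_def sum_distrib_right)
  also have "\<dots> = (\<Sum>a<N. of_real (((cmod (dft N q a))\<^sup>2)\<^sup>2))"
    by (simp only: power2_eq_square [of "(cmod _)\<^sup>2"] of_real_mult complex_norm_square mult.assoc)
  finally show ?thesis by simp
qed

section \<open>Fourier inversion, Parseval and the lower bound\<close>

lemma dft_inversion:
  assumes "N \<ge> 1" and "i < N"
  shows "(\<Sum>a<N. root1 N ^ (a * i) * cnj (dft N q a)) = of_nat N * cnj (q i)"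
proof -
  have "(\<Sum>a<N. root1 N ^ (a * i) * cnj (dft N q a))
      = (\<Sum>a<N. \<Sum>j<N. cnj (q j) * (root1 N ^ (a * i) * cnj (root1 N ^ (a * j))))"
    by (simp add: dft_def sum_distrib_left mult_ac)
  also have "\<dots> = (\<Sum>j<N. \<Sum>a<N. cnj (q j) * (root1 N ^ (a * i) * cnj (root1 N ^ (a * j))))"
    by (rule sum.swap)
  \<comment> \<open>For indices below \<open>N\<close>, congruence modulo \<open>N\<close> is
    equality.\<close>
  also have "\<dots> = (\<Sum>j<N. if i = j then cnj (q j) * of_nat N else 0)"
    unfolding sum_distrib_left [symmetric] sum_root1_orthogonal [OF assms(1)]
    using assms(2) by (intro sum.cong refl) (auto simp: cong_def)
  also have "\<dots> = of_nat N * cnj (q i)"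
    using assms(2) by (simp add: sum.delta')
  finally show ?thesis .
qed

text \<open>Only one factor of \<open>dft N q a * cnj (dft N q a)\<close> is expanded; the sum over
  \<open>a\<close> is then an instance of \<open>dft_inversion\<close>.\<close>

lemma dft_parseval:
  assumes "N \<ge> 1"
  shows "(\<Sum>a<N. (cmod (dft N q a))\<^sup>2) = real N * (\<Sum>i<N. (cmod (q i))\<^sup>2)"
proof -
  have "complex_of_real (\<Sum>a<N. (cmod (dft N q a))\<^sup>2)
      = (\<Sum>a<N. \<Sum>i<N. q i * (root1 N ^ (a * i) * cnj (dft N q a)))"
    unfolding of_real_sum complex_norm_square
    by (simp add: dft_def [of N q] sum_distrib_right mult.assoc del: cnj_sum)
  also have "\<dots> = (\<Sum>i<N. \<Sum>a<N. q i * (root1 N ^ (a * i) * cnj (dft N q a)))"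
    by (rule sum.swap)
  also have "\<dots> = (\<Sum>i<N. q i * (of_nat N * cnj (q i)))"
    unfolding sum_distrib_left [symmetric]
    by (intro sum.cong refl) (simp add: dft_inversion [OF assms])
  also have "\<dots> = complex_of_real (real N * (\<Sum>i<N. (cmod (q i))\<^sup>2))"
    by (simp only: of_real_mult of_real_sum of_real_of_nat_eq complex_norm_square
        sum_distrib_left mult.left_commute)
  finally show ?thesis by (simp only: of_real_eq_iff)
qed

lemma Phi_real_ge:
  assumes "N \<ge> 1" and "\<And>i. i < N \<Longrightarrow> cmod (q i) = 1"
  shows "Phi N q \<in> \<real>" and "Re (Phi N q) \<ge> (real N)\<^sup>2"
proof -
  let ?P = "\<Sum>a<N. ((cmod (dft N q a))\<^sup>2)\<^sup>2"
  have Phi: "Phi N q = of_real (?P / real N)"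
    using Phi_dft [of N q] assms by (simp add: field_simps)
  then show "Phi N q \<in> \<real>"
    by (metis Reals_of_real)
  have parseval: "(\<Sum>a<N. (cmod (dft N q a))\<^sup>2) = (real N)\<^sup>2"
    unfolding dft_parseval [OF assms(1)] by (simp add: assms(2) power2_eq_square)
  \<comment> \<open>By Parseval, \<open>N\<close> is the mean of the squared moduli, so this is
    \<open>N\<close> times their variance.\<close>
  have "0 \<le> (\<Sum>a<N. ((cmod (dft N q a))\<^sup>2 - real N)\<^sup>2)"
    by (intro sum_nonneg) simp
  also have "\<dots> = ?P + (real N * (real N)\<^sup>2 - 2 * real N * (\<Sum>a<N. (cmod (dft N q a))\<^sup>2))"
    by (simp add: power2_diff sum.distrib sum_subtractf sum_distrib_left mult_ac)
  also have "\<dots> = ?P - real N * (real N)\<^sup>2"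
    unfolding parseval by simp
  finally have "(real N)\<^sup>2 \<le> ?P / real N"
    using assms(1) by (simp add: field_simps)
  then show "Re (Phi N q) \<ge> (real N)\<^sup>2"
    by (simp only: Phi Re_complex_of_real)
qed

section \<open>The Hadamard case\<close>

text \<open>Column 0 of the adjoint Fourier matrix is constant, its exponents being 0. This one
  column of the circulant matrix contains all Fourier coefficients of \<open>q\<close> up to
  scaling.\<close>

lemma circulant_of_column_0:
  assumes "a < N"
  shows "circulant_of N q $$ (a, 0) = dft N q a / of_real (sqrt (real N))"
proof -
  have "N > 0" using assms by simp
  have F: "fourier_mat N \<in> carrier_mat N N"
    by (simp add: fourier_mat_def)
  have Fa: "mat_adjoint (fourier_mat N) \<in> carrier_mat N N"
    by (intro carrier_matI) (simp_all add: mat_adjoint_def fourier_mat_def)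
  have adj: "mat_adjoint (fourier_mat N) $$ (j, 0) = 1 / of_real (sqrt (real N))" if "j < N" for j
    using that \<open>N > 0\<close>
    by (simp add: mat_adjoint_def mat_of_rows_def fourier_mat_def)
  have "(fourier_mat N * mat_diag N q * mat_adjoint (fourier_mat N)) $$ (a, 0)
      = (\<Sum>j<N. (fourier_mat N $$ (a, j) * q j) * mat_adjoint (fourier_mat N) $$ (j, 0))"
    using F Fa assms \<open>N > 0\<close>
    by (simp add: mat_diag_mult_right [OF F] scalar_prod_def atLeast0LessThan)
  also have "\<dots> = (\<Sum>j<N. q j * root1 N ^ (a * j) / of_nat N)"
    using assms
    by (intro sum.cong refl) (simp add: adj, simp add: fourier_mat_def root1_def flip: of_real_mult)
  also have "\<dots> = dft N q a / of_nat N"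
    by (simp only: dft_def sum_divide_distrib)
  finally have "circulant_of N q $$ (a, 0) = of_real (sqrt (real N)) * (dft N q a / of_nat N)"
    unfolding circulant_of_def using F Fa assms \<open>N > 0\<close>
    by (subst index_smult_mat(1)) (simp_all del: index_mult_mat(1))
  moreover have "of_nat N = complex_of_real (sqrt (real N)) * of_real (sqrt (real N))"
    by (simp flip: of_real_mult)
  ultimately show ?thesis
    using \<open>N > 0\<close> by (simp add: field_simps)
qed

lemma dft_norm_of_hadamard:
  assumes "complex_hadamard (circulant_of N q)" and "a < N"
  shows "(cmod (dft N q a))\<^sup>2 = real N"
proof -
  have "dim_row (circulant_of N q) = N" "dim_col (circulant_of N q) = N"
    by (simp_all add: circulant_of_def fourier_mat_def mat_adjoint_def)
  then have "cmod (circulant_of N q $$ (a, 0)) = 1"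
    using assms unfolding complex_hadamard_def by auto
  then have "cmod (dft N q a) = sqrt (real N)"
    using assms(2) by (simp add: circulant_of_column_0 norm_divide field_simps)
  then show ?thesis
    by simp
qed

text \<open>The constant \<open>N\<close> replaces the squared modulus in \<open>Phi_at_dft\<close>,
  and the remaining sum is the one in \<open>dft_inversion\<close>.\<close>

lemma Phi_at_of_hadamard:
  assumes "N \<ge> 1" and "\<And>i. i < N \<Longrightarrow> cmod (q i) = 1"
    and "complex_hadamard (circulant_of N q)" and "i < N"
  shows "Phi_at N q i = of_nat N"
proof -
  have "of_nat N * Phi_at N q i
      = (\<Sum>a<N. q i * root1 N ^ (a * i) * cnj (dft N q a) * of_real ((cmod (dft N q a))\<^sup>2))"
    using Phi_at_dft assms(1,2,4) by blast
  also have "\<dots> = of_nat N * (q i * (\<Sum>a<N. root1 N ^ (a * i) * cnj (dft N q a)))"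
    unfolding sum_distrib_left
    by (intro sum.cong refl) (simp add: dft_norm_of_hadamard [OF assms(3)] del: of_real_power)
  also have "\<dots> = of_nat N * (of_nat N * (q i * cnj (q i)))"
    by (simp add: dft_inversion [OF assms(1,4)])
  also have "q i * cnj (q i) = 1"
    using assms(2,4) by (simp flip: complex_norm_square)
  finally show ?thesis
    using assms(1) by simp
qed

section \<open>Derivatives in the angles and critical points\<close>

text \<open>The quotient is the exponential of \<i> times a signed sum of angles. The indicators add
  up to the slope of that sum in the angle \<open>r\<close>, also when indices coincide.\<close>

lemma has_vector_derivative_unimodular_term:
  "((\<lambda>t. (torus_pt (\<alpha>(r := t)) i * torus_pt (\<alpha>(r := t)) k) /
          (torus_pt (\<alpha>(r := t)) j * torus_pt (\<alpha>(r := t)) l))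
    has_vector_derivative
     (\<i> * (of_bool (i = r) + of_bool (k = r) - of_bool (j = r) - of_bool (l = r)) *
       ((torus_pt \<alpha> i * torus_pt \<alpha> k) / (torus_pt \<alpha> j * torus_pt \<alpha> l)))) (at (\<alpha> r))"
proof -
  have quot: "(torus_pt \<beta> i * torus_pt \<beta> k) / (torus_pt \<beta> j * torus_pt \<beta> l)
      = exp (\<i> * of_real (\<beta> i + \<beta> k - \<beta> j - \<beta> l))" for \<beta>
    by (simp add: torus_pt_def exp_add exp_diff ring_distribs)
  let ?d = "of_bool (i = r) + of_bool (k = r) - of_bool (j = r) - of_bool (l = r)"
  let ?s = "\<lambda>t. (\<alpha>(r := t)) i + (\<alpha>(r := t)) k - (\<alpha>(r := t)) j - (\<alpha>(r := t)) l"
  have "((\<lambda>t. (\<alpha>(r := t)) x) has_real_derivative of_bool (x = r)) (at (\<alpha> r))" for x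
    by (cases "x = r") auto
  then have "(?s has_real_derivative ?d) (at (\<alpha> r))"
    by (intro derivative_intros)
  then have "((\<lambda>t. \<i> * of_real (?s t)) has_vector_derivative \<i> * of_real ?d) (at (\<alpha> r))"
    by (intro has_vector_derivative_mult_right has_vector_derivative_of_real)
      (simp add: has_real_derivative_iff_has_vector_derivative)
  from field_vector_diff_chain_at [OF this DERIV_exp]
  have "((\<lambda>t. exp (\<i> * of_real (?s t))) has_vector_derivative
      (\<i> * of_real ?d) * exp (\<i> * of_real (?s (\<alpha> r)))) (at (\<alpha> r))"
    by (simp only: o_def)
  moreover have "complex_of_real (of_bool b) = of_bool b" for b
    by (cases b) simp_all
  ultimately show ?thesis
    unfolding quot by (simp only: of_real_add of_real_diff fun_upd_triv)
qed

lemma has_vector_derivative_Phi: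
  assumes "r < N"
  shows "((\<lambda>t. Phi N (torus_pt (\<alpha>(r := t)))) has_vector_derivative
    of_real (- 4 * Im (Phi_at N (torus_pt \<alpha>) r))) (at (\<alpha> r))"
proof -
  define T where "T i j k l =
    (if [i + k = j + l] (mod N)
     then (torus_pt \<alpha> i * torus_pt \<alpha> k) / (torus_pt \<alpha> j * torus_pt \<alpha> l) else 0)" for i j k l
  let ?P = "Phi_at N (torus_pt \<alpha>) r"
  let ?D = "\<Sum>i<N. \<Sum>j<N. \<Sum>k<N. \<Sum>l<N.
    \<i> * (of_bool (i = r) + of_bool (k = r) - of_bool (j = r) - of_bool (l = r)) * T i j k l"
  have P: "?P = (\<Sum>j<N. \<Sum>k<N. \<Sum>l<N. T r j k l)"
    by (simp add: Phi_at_eq_sum T_def)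
  \<comment> \<open>These symmetries move \<open>r\<close> from any of the four positions to the
    first: swaps within numerator or denominator keep the term, exchanging the two conjugates
    it.\<close>
  have T_swap: "T i j k l = T k j i l" "T i j k l = T i l k j" for i j k l
    by (simp_all add: T_def add.commute mult.commute)
  have T_cnj: "T j i l k = cnj (T i j k l)" for i j k l
    by (auto simp: T_def torus_pt_def exp_cnj exp_minus field_simps cong_sym_eq)
  have collapse: "(\<Sum>x<N. of_bool (x = r) * f x) = f r" for f :: "nat \<Rightarrow> complex"
    using assms by (simp add: of_bool_def if_distrib [of "\<lambda>c. c * _"] sum.delta cong: if_cong)
  have 1: "(\<Sum>i<N. \<Sum>j<N. \<Sum>k<N. \<Sum>l<N. of_bool (i = r) * T i j k l) = ?P"
    unfolding P by (simp only: sum_distrib_left [symmetric] collapse)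
  have 2: "(\<Sum>i<N. \<Sum>j<N. \<Sum>k<N. \<Sum>l<N. of_bool (k = r) * T i j k l) = ?P"
  proof -
    have "(\<Sum>i<N. \<Sum>j<N. \<Sum>k<N. \<Sum>l<N. of_bool (k = r) * T i j k l)
        = (\<Sum>i<N. \<Sum>j<N. \<Sum>l<N. T i j r l)"
      by (simp only: sum_distrib_left [symmetric] collapse)
    also have "\<dots> = (\<Sum>i<N. \<Sum>j<N. \<Sum>l<N. T r j i l)"
      by (intro sum.cong refl T_swap(1))
    also have "\<dots> = ?P"
      unfolding P by (rule sum.swap)
    finally show ?thesis .
  qed
  have 3: "(\<Sum>i<N. \<Sum>j<N. \<Sum>k<N. \<Sum>l<N. of_bool (j = r) * T i j k l) = cnj ?P"
  proof -
    have "(\<Sum>i<N. \<Sum>j<N. \<Sum>k<N. \<Sum>l<N. of_bool (j = r) * T i j k l)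
        = (\<Sum>i<N. \<Sum>k<N. \<Sum>l<N. T i r k l)"
      by (simp only: sum_distrib_left [symmetric] collapse)
    \<comment> \<open>After \<open>T_cnj\<close> the term is \<open>cnj (T r i l k)\<close>, whose
      arguments now come in the order of summation.\<close>
    also have "\<dots> = (\<Sum>i<N. \<Sum>l<N. \<Sum>k<N. T i r k l)"
      by (intro sum.cong refl sum.swap)
    also have "\<dots> = cnj ?P"
      unfolding P by (simp add: T_cnj [of _ r])
    finally show ?thesis .
  qed
  have 4: "(\<Sum>i<N. \<Sum>j<N. \<Sum>k<N. \<Sum>l<N. of_bool (l = r) * T i j k l) = cnj ?P"
  proof -
    have "(\<Sum>i<N. \<Sum>j<N. \<Sum>k<N. \<Sum>l<N. of_bool (l = r) * T i j k l)
        = (\<Sum>i<N. \<Sum>j<N. \<Sum>k<N. T i r k j)"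
      by (simp only: collapse T_swap(2) [of _ _ _ r])
    also have "\<dots> = (\<Sum>i<N. \<Sum>j<N. \<Sum>k<N. cnj (T r i j k))"
      by (simp only: T_cnj [of _ r])
    also have "\<dots> = cnj ?P"
      unfolding P by simp
    finally show ?thesis .
  qed
  have "?D = \<i> * ((\<Sum>i<N. \<Sum>j<N. \<Sum>k<N. \<Sum>l<N. of_bool (i = r) * T i j k l)
      + (\<Sum>i<N. \<Sum>j<N. \<Sum>k<N. \<Sum>l<N. of_bool (k = r) * T i j k l)
      - (\<Sum>i<N. \<Sum>j<N. \<Sum>k<N. \<Sum>l<N. of_bool (j = r) * T i j k l)
      - (\<Sum>i<N. \<Sum>j<N. \<Sum>k<N. \<Sum>l<N. of_bool (l = r) * T i j k l))"
    by (simp only: sum_distrib_left sum.distrib sum_subtractf ring_distribs mult.assoc)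
  \<comment> \<open>Here \<open>?P - cnj ?P\<close> is \<open>2 * \<i> * Im ?P\<close>, and it
    occurs twice.\<close>
  also have "\<dots> = of_real (- 4 * Im ?P)"
    unfolding 1 2 3 4 by (simp add: complex_eq_iff)
  finally have D: "?D = of_real (- 4 * Im ?P)" .
  have "((\<lambda>t. Phi N (torus_pt (\<alpha>(r := t)))) has_vector_derivative ?D) (at (\<alpha> r))"
    unfolding Phi_eq_sum T_def
  proof (intro has_vector_derivative_sum)
    fix i j k l
    show "((\<lambda>t. if [i + k = j + l] (mod N)
          then (torus_pt (\<alpha>(r := t)) i * torus_pt (\<alpha>(r := t)) k) /
            (torus_pt (\<alpha>(r := t)) j * torus_pt (\<alpha>(r := t)) l) else 0)
        has_vector_derivative
        \<i> * (of_bool (i = r) + of_bool (k = r) - of_bool (j = r) - of_bool (l = r)) *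
          (if [i + k = j + l] (mod N)
           then (torus_pt \<alpha> i * torus_pt \<alpha> k) / (torus_pt \<alpha> j * torus_pt \<alpha> l) else 0)) (at (\<alpha> r))"
      using has_vector_derivative_unimodular_term
      by (cases "[i + k = j + l] (mod N)") (simp_all only: if_True if_False mult_zero_right has_vector_derivative_const)
  qed
  then show ?thesis
    unfolding D .
qed

text \<open>Derivatives are unique, so the one computed above is 0 exactly when the imaginary part
  of \<open>Phi_at\<close> is.\<close>

lemma critical_point_Phi_iff:
  "critical_point_Phi N \<alpha> \<longleftrightarrow> (\<forall>i<N. Phi_at N (torus_pt \<alpha>) i \<in> \<real>)"
proof -
  have "((\<lambda>t. Phi N (torus_pt (\<alpha>(i := t)))) has_vector_derivative 0) (at (\<alpha> i))
      \<longleftrightarrow> Phi_at N (torus_pt \<alpha>) i \<in> \<real>" if "i < N" for i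
    using has_vector_derivative_Phi [OF that, of \<alpha>]
    by (auto simp: complex_is_Real_iff dest: vector_derivative_unique_at)
  then show ?thesis
    unfolding critical_point_Phi_def by blast
qed

text \<open>Transfers the criterion from \<open>torus_pt \<alpha>\<close> to \<open>q\<close>, as
  the two are only known to agree below \<open>N\<close>.\<close>

lemma Phi_at_cong:
  assumes "\<And>i. i < N \<Longrightarrow> p i = q i" and "i < N"
  shows "Phi_at N p i = Phi_at N q i"
  unfolding Phi_at_eq_sum using assms by (intro sum.cong refl) auto

theorem theorem5p1:
  fixes N :: nat and q :: "nat \<Rightarrow> complex"
  assumes "N \<ge> 1"
    and "\<And>i. i < N \<Longrightarrow> cmod (q i) = 1"
  shows "Phi N q = (\<Sum>i<N. Phi_at N q i) \<and>
         (Phi N q \<in> \<real> \<and> Re (Phi N q) \<ge> (real N)\<^sup>2 \<and>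
           (complex_hadamard (circulant_of N q) \<longrightarrow> Phi N q = (of_nat N)\<^sup>2)) \<and>
         (\<forall>\<alpha> :: nat \<Rightarrow> real. (\<forall>i<N. q i = torus_pt \<alpha> i) \<longrightarrow>
           (critical_point_Phi N \<alpha> \<longleftrightarrow> (\<forall>i<N. Phi_at N q i \<in> \<real>))) \<and>
         (complex_hadamard (circulant_of N q) \<longrightarrow> (\<forall>i<N. Phi_at N q i = of_nat N))"
proof (intro conjI allI impI)
  show "Phi N q = (\<Sum>i<N. Phi_at N q i)"
    by (rule Phi_eq_sum_Phi_at)
  show "Phi N q \<in> \<real>" "Re (Phi N q) \<ge> (real N)\<^sup>2"
    using Phi_real_ge assms by blast+
  show at: "Phi_at N q i = of_nat N" if "complex_hadamard (circulant_of N q)" "i < N" for i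
    using Phi_at_of_hadamard assms that by blast
  show "Phi N q = (of_nat N)\<^sup>2" if "complex_hadamard (circulant_of N q)"
    by (simp add: Phi_eq_sum_Phi_at at that power2_eq_square)
  fix \<alpha> :: "nat \<Rightarrow> real"
  assume "\<forall>i<N. q i = torus_pt \<alpha> i"
  then show "critical_point_Phi N \<alpha> \<longleftrightarrow> (\<forall>i<N. Phi_at N q i \<in> \<real>)"
    using Phi_at_cong [of N q "torus_pt \<alpha>"] by (simp add: critical_point_Phi_iff)
qed

end
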